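(* For any infinite set $Y$ there exists an absolutely homogeneous GEC $\mathfrak H=(V,\kappa)$ such that $\mathrm{Col}(\mathfrak H)=Y$ and $\mathrm{card}(V)=2^{\mathrm{card}(Y)}$.
   Context: A GEC (full graph with edge-coloring) is a pair $\mathfrak{G}=(V,\kappa)$ where $V$ is a set of vertices and $\kappa$ is a function defined on $V\times V$ such that for all $x,y,z\in V$: $\kappa(x,y)=\kappa(z,z)\iff x=y$; and $\kappa(y,x)=\kappa(x,y)$. The palette is $\mathrm{Col}(\mathfrak G)=\{\kappa(x,y): x\neq y\}$ (the value $\kappa(z,z)$ is not counted as a color). A partial morphism of $(V,\kappa)$ is a function $f\colon A\to V$ with $A\subset V$ and $\kappa(a,b)=\kappa(f(a),f(b))$ for all $a,b\in A$; an automorphism is a bijective partial morphism $V\to V$. A GEC is absolutely homogeneous if every its partial morphism extends to an automorphism. *)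

theory Defs
  imports Main
begin

unbundle cardinal_syntax

text \<open>A full graph with edge-coloring; only the values of \<open>\<kappa>\<close> on \<open>V \<times> V\<close> matter.\<close>

definition GEC :: "'v set \<Rightarrow> ('v \<Rightarrow> 'v \<Rightarrow> 'c) \<Rightarrow> bool" where
  "GEC V \<kappa> \<longleftrightarrow>
     (\<forall>x\<in>V. \<forall>y\<in>V. \<forall>z\<in>V. \<kappa> x y = \<kappa> z z \<longleftrightarrow> x = y) \<and>
     (\<forall>x\<in>V. \<forall>y\<in>V. \<kappa> y x = \<kappa> x y)"

definition Col :: "'v set \<Rightarrow> ('v \<Rightarrow> 'v \<Rightarrow> 'c) \<Rightarrow> 'c set" where
  "Col V \<kappa> = {\<kappa> x y | x y. x \<in> V \<and> y \<in> V \<and> x \<noteq> y}"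

text \<open>The domain \<open>A\<close> of a partial morphism is an arbitrary subset of \<open>V\<close>: it may be infinite,
  empty or all of \<open>V\<close>.\<close>

definition partial_morphism ::
  "'v set \<Rightarrow> ('v \<Rightarrow> 'v \<Rightarrow> 'c) \<Rightarrow> 'v set \<Rightarrow> ('v \<Rightarrow> 'v) \<Rightarrow> bool" where
  "partial_morphism V \<kappa> A f \<longleftrightarrow>
     A \<subseteq> V \<and> f ` A \<subseteq> V \<and> (\<forall>a\<in>A. \<forall>b\<in>A. \<kappa> a b = \<kappa> (f a) (f b))"

definition automorphism :: "'v set \<Rightarrow> ('v \<Rightarrow> 'v \<Rightarrow> 'c) \<Rightarrow> ('v \<Rightarrow> 'v) \<Rightarrow> bool" where
  "automorphism V \<kappa> g \<longleftrightarrow> partial_morphism V \<kappa> V g \<and> bij_betw g V V"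

definition absolutely_homogeneous :: "'v set \<Rightarrow> ('v \<Rightarrow> 'v \<Rightarrow> 'c) \<Rightarrow> bool" where
  "absolutely_homogeneous V \<kappa> \<longleftrightarrow>
     (\<forall>A f. partial_morphism V \<kappa> A f \<longrightarrow>
        (\<exists>g. automorphism V \<kappa> g \<and> (\<forall>a\<in>A. g a = f a)))"

text \<open>The diagonal value of a coloring is never a color, so a coloring with palette \<open>Y\<close>
  needs a value outside \<open>Y\<close>. As \<open>Y :: 'a set\<close> may be all of \<open>UNIV\<close>, the theorem
  takes colorings with values in \<open>'a option\<close> and identifies \<open>Y\<close> with \<open>Some ` Y\<close>.\<close>

end

theory Submission
  imports Defs
begin

text \<open>
  The vertices are the subsets of \<open>Y\<close>, read as \<open>0\<close>-\<open>1\<close> sequences indexed by \<open>Y\<close> along some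
  well-order, and the color of an edge is the first index at which its two ends differ. Every
  \<open>y \<in> Y\<close> is a color because \<open>{}\<close> and \<open>{y}\<close> differ at \<open>y\<close> only.

  A map preserving first differences is an isometry of the generalized ultrametric on these
  sequences, equivalently a partial isomorphism of the full binary tree of initial segments. It
  extends one bit at a time. Given \<open>f\<close> on \<open>A\<close> and an arbitrary sequence \<open>x\<close>, the image of \<open>x\<close>
  has to flip the bit \<open>x\<^sub>b\<close> exactly when \<open>f\<close> flips the bit \<open>b\<close> of some \<open>a \<in> A\<close> that agrees
  with \<open>x\<close> before \<open>b\<close>; all such \<open>a\<close> agree with each other before \<open>b\<close>, so \<open>f\<close> flips the
  bit \<open>b\<close> of all or none of them (\<open>mem_extend_iff\<close>). Where no such \<open>a\<close> exists there is no
  constraint and the bit is kept. Whether bit \<open>b\<close> is flipped thus depends only on the bits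
  before \<open>b\<close>, which makes the extension preserve first differences (\<open>first_difference_extend\<close>);
  the extension of the inverse of \<open>f\<close> undoes these flips, so the extension of \<open>f\<close> is onto
  (\<open>extend_inverse\<close>).
\<close>

section \<open>First differences of sets along a well-order\<close>

locale strict_well_order =
  fixes R :: "'a rel"
  assumes wf_R: "wf R" and total_R: "total R" and trans_R: "trans R"
begin

definition agree_below :: "'a \<Rightarrow> 'a set \<Rightarrow> 'a set \<Rightarrow> bool" where
  "agree_below b x y \<longleftrightarrow> (\<forall>c. (c, b) \<in> R \<longrightarrow> (c \<in> x \<longleftrightarrow> c \<in> y))"

definition first_difference :: "'a set \<Rightarrow> 'a set \<Rightarrow> 'a option" where
  "first_difference x y =
     (if x = y then None else Some (THE b. agree_below b x y \<and> (b \<in> x \<longleftrightarrow> b \<notin> y)))"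

lemma agree_below_refl: "agree_below b x x"
  by (simp add: agree_below_def)

lemma agree_below_sym: "agree_below b x y \<Longrightarrow> agree_below b y x"
  by (simp add: agree_below_def)

lemma agree_below_trans: "agree_below b x y \<Longrightarrow> agree_below b y z \<Longrightarrow> agree_below b x z"
  by (simp add: agree_below_def)

lemma agree_below_less: "agree_below b x y \<Longrightarrow> (c, b) \<in> R \<Longrightarrow> agree_below c x y"
  unfolding agree_below_def using trans_R by (meson transD)

lemma agree_everywhere_imp_eq:
  assumes "\<And>b. agree_below b x y \<Longrightarrow> b \<in> x \<longleftrightarrow> b \<in> y"
  shows "x = y"
proof -
  have "b \<in> x \<longleftrightarrow> b \<in> y" for b
    using wf_R
  proof (induction b rule: wf_induct_rule)
    case (less b)
    then show ?case
      using assms[of b] by (simp add: agree_below_def)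
  qed
  then show ?thesis by blast
qed

lemma first_difference_eq_None_iff [simp]: "first_difference x y = None \<longleftrightarrow> x = y"
  by (simp add: first_difference_def)

lemma first_difference_eq_Some_iff:
  "first_difference x y = Some b \<longleftrightarrow> agree_below b x y \<and> (b \<in> x \<longleftrightarrow> b \<notin> y)"
proof -
  let ?P = "\<lambda>b. agree_below b x y \<and> (b \<in> x \<longleftrightarrow> b \<notin> y)"
  have unique: "b = c" if "?P b" "?P c" for b c
    using that total_R unfolding agree_below_def total_on_def by blast
  show ?thesis
  proof (cases "x = y")
    case True
    then show ?thesis by (simp add: first_difference_def)
  next
    case False
    then obtain c where c: "?P c"
      using agree_everywhere_imp_eq[of x y] by auto
    then have "(THE b. ?P b) = c"
      by (rule the_equality) (rule unique[OF _ c])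
    with False have "first_difference x y = Some c"
      by (simp add: first_difference_def)
    then show ?thesis
      using c unique[of b c] by auto
  qed
qed

lemma first_difference_sym: "first_difference y x = first_difference x y"
proof -
  have "agree_below b y x \<and> (b \<in> y \<longleftrightarrow> b \<notin> x) \<longleftrightarrow> agree_below b x y \<and> (b \<in> x \<longleftrightarrow> b \<notin> y)" for b
    by (auto simp: agree_below_def)
  then show ?thesis
    unfolding first_difference_def by (simp only: eq_commute[of y x])
qed

lemma agree_below_iff_first_difference:
  "agree_below b x y \<longleftrightarrow> (\<forall>c. first_difference x y = Some c \<longrightarrow> (c, b) \<notin> R)"
proof
  assume "agree_below b x y"
  then show "\<forall>c. first_difference x y = Some c \<longrightarrow> (c, b) \<notin> R"
    by (auto simp: first_difference_eq_Some_iff agree_below_def)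
next
  assume *: "\<forall>c. first_difference x y = Some c \<longrightarrow> (c, b) \<notin> R"
  show "agree_below b x y"
  proof (cases "first_difference x y")
    case None
    then show ?thesis by (simp add: agree_below_refl)
  next
    case (Some c)
    with * have "b = c \<or> (b, c) \<in> R"
      using total_R by (auto simp: total_on_def)
    with Some show ?thesis
      by (auto simp: first_difference_eq_Some_iff intro: agree_below_less)
  qed
qed

text \<open>Since a first difference determines, and is determined by, the bits compared one after
  another, preserving it can be tested and used bit by bit.\<close>

lemma first_difference_eq_iff:
  "first_difference x y = first_difference u v \<longleftrightarrow>
     (\<forall>b. agree_below b x y \<longrightarrow>
        agree_below b u v \<and> ((b \<in> x \<longleftrightarrow> b \<in> y) \<longleftrightarrow> (b \<in> u \<longleftrightarrow> b \<in> v)))"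
  (is "?L \<longleftrightarrow> ?R")
proof
  assume eq: ?L
  show ?R
  proof (intro allI impI)
    fix b
    assume xy: "agree_below b x y"
    then have uv: "agree_below b u v"
      by (simp add: eq agree_below_iff_first_difference)
    have "first_difference x y = Some b \<longleftrightarrow> first_difference u v = Some b"
      by (simp add: eq)
    with xy uv show "agree_below b u v \<and> ((b \<in> x \<longleftrightarrow> b \<in> y) \<longleftrightarrow> (b \<in> u \<longleftrightarrow> b \<in> v))"
      by (auto simp: first_difference_eq_Some_iff)
  qed
next
  assume R: ?R
  show ?L
  proof (cases "first_difference x y")
    case None
    with R have "u = v"
      by (intro agree_everywhere_imp_eq) (auto simp: agree_below_refl)
    with None show ?thesis
      by (metis first_difference_eq_None_iff)
  next
    case (Some b)
    with R have "first_difference u v = Some b"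
      unfolding first_difference_eq_Some_iff by blast
    with Some show ?thesis by simp
  qed
qed

section \<open>Extending maps that preserve first differences\<close>

definition preserves_first_difference :: "'a set set \<Rightarrow> ('a set \<Rightarrow> 'a set) \<Rightarrow> bool" where
  "preserves_first_difference A f \<longleftrightarrow>
     (\<forall>a\<in>A. \<forall>b\<in>A. first_difference a b = first_difference (f a) (f b))"

text \<open>Both inequalities are exclusive or of bits: the outer one applies a flip, the inner one
  records whether \<open>f\<close> makes that flip at \<open>a\<close>. Bits without a witness \<open>a\<close> are kept.\<close>

definition extend :: "'a set set \<Rightarrow> ('a set \<Rightarrow> 'a set) \<Rightarrow> 'a set \<Rightarrow> 'a set" where
  "extend A f x =
     {b. (b \<in> x) \<noteq> (\<exists>a\<in>A. agree_below b a x \<and> (b \<in> a) \<noteq> (b \<in> f a))}"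

lemma extend_subset:
  assumes "\<Union>A \<subseteq> Y" "\<Union>(f ` A) \<subseteq> Y" "x \<subseteq> Y"
  shows "extend A f x \<subseteq> Y"
  using assms unfolding extend_def by blast

text \<open>The witness \<open>a\<close> in the definition of the extension may be replaced by any other: two
  witnesses share their bits before \<open>b\<close>, and then their \<open>b\<close>-th bits differ before applying
  \<open>f\<close> if and only if they differ afterwards.\<close>

lemma mem_extend_iff:
  assumes f: "preserves_first_difference A f" and a: "a \<in> A" "agree_below b a x"
  shows "b \<in> extend A f x \<longleftrightarrow> ((b \<in> x) \<noteq> ((b \<in> a) \<noteq> (b \<in> f a)))"
proof -
  have "(b \<in> a) \<noteq> (b \<in> f a) \<longleftrightarrow> (b \<in> a') \<noteq> (b \<in> f a')"
    if a': "a' \<in> A" "agree_below b a' x" for a'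
  proof -
    have "agree_below b a a'"
      using a a' by (blast intro: agree_below_sym agree_below_trans)
    moreover have "first_difference a a' = first_difference (f a) (f a')"
      using f a a' by (simp add: preserves_first_difference_def)
    ultimately show ?thesis
      unfolding first_difference_eq_iff by blast
  qed
  then show ?thesis
    using a unfolding extend_def by blast
qed

lemma extend_eq:
  assumes "preserves_first_difference A f" "a \<in> A"
  shows "extend A f a = f a"
  using mem_extend_iff[OF assms agree_below_refl] by blast

text \<open>Sequences that agree before \<open>b\<close> have the same witnesses for a flip at \<open>b\<close>, so their
  \<open>b\<close>-th bits are both flipped or both kept.\<close>

lemma first_difference_extend:
  "first_difference (extend A f x) (extend A f y) = first_difference x y"
proof -
  have same_flip: "(b \<in> x \<longleftrightarrow> b \<in> y) \<longleftrightarrow> (b \<in> extend A f x \<longleftrightarrow> b \<in> extend A f y)"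
    if "agree_below b x y" for b
  proof -
    have "agree_below b a x \<longleftrightarrow> agree_below b a y" for a
      using that by (blast intro: agree_below_sym agree_below_trans)
    then show ?thesis by (auto simp: extend_def)
  qed
  have "agree_below b (extend A f x) (extend A f y)" if b: "agree_below b x y" for b
    unfolding agree_below_def
  proof (intro allI impI)
    fix c
    assume c: "(c, b) \<in> R"
    then have "c \<in> x \<longleftrightarrow> c \<in> y"
      using b by (simp add: agree_below_def)
    with same_flip[OF agree_below_less[OF b c]]
    show "c \<in> extend A f x \<longleftrightarrow> c \<in> extend A f y" by simp
  qed
  with same_flip have "first_difference x y = first_difference (extend A f x) (extend A f y)"
    unfolding first_difference_eq_iff by blast
  then show ?thesis by simp
qed

lemma agree_below_extend_iff:
  "agree_below b (extend A f x) (extend A f y) \<longleftrightarrow> agree_below b x y"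
  by (simp add: agree_below_iff_first_difference first_difference_extend)

lemma preserves_first_difference_imp_inj_on:
  assumes "preserves_first_difference A f"
  shows "inj_on f A"
  using assms unfolding preserves_first_difference_def inj_on_def
  by (metis first_difference_eq_None_iff)

text \<open>By induction along the well-order: once the composite fixes the bits before \<open>b\<close>, an
  element \<open>a\<close> of \<open>A\<close> is a witness for the second map exactly if \<open>f a\<close> is one for the first,
  so either both maps flip the \<open>b\<close>-th
  bit or neither does.\<close>

lemma extend_inverse:
  assumes f: "preserves_first_difference A f"
  shows "extend A f (extend (f ` A) (inv_into A f) y) = y"
proof -
  define h where "h = extend (f ` A) (inv_into A f)"
  have inv: "inv_into A f (f a) = a" if "a \<in> A" for a
    using f that by (simp add: preserves_first_difference_imp_inj_on)
  have pres_inv: "preserves_first_difference (f ` A) (inv_into A f)"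
    using f by (simp add: preserves_first_difference_def inv)
  have "b \<in> extend A f (h y) \<longleftrightarrow> b \<in> y" if "agree_below b (extend A f (h y)) y" for b
  proof (cases "\<exists>a\<in>A. agree_below b (f a) y")
    case True
    then obtain a where a: "a \<in> A" "agree_below b (f a) y" by blast
    then have "agree_below b (extend A f a) (extend A f (h y))"
      using that f by (metis agree_below_sym agree_below_trans extend_eq)
    then have "agree_below b a (h y)"
      by (simp add: agree_below_extend_iff)
    then have "b \<in> extend A f (h y) \<longleftrightarrow> ((b \<in> h y) \<noteq> ((b \<in> a) \<noteq> (b \<in> f a)))"
      using f a by (intro mem_extend_iff)
    moreover have "b \<in> h y \<longleftrightarrow> ((b \<in> y) \<noteq> ((b \<in> f a) \<noteq> (b \<in> a)))"
      using mem_extend_iff[OF pres_inv _ a(2)] a by (simp add: h_def inv)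
    ultimately show ?thesis by blast
  next
    case False
    then have "b \<in> h y \<longleftrightarrow> b \<in> y"
      by (auto simp: h_def extend_def)
    moreover have "\<not> agree_below b a (h y)" if "a \<in> A" for a
    proof
      assume "agree_below b a (h y)"
      then have "agree_below b (extend A f a) (extend A f (h y))"
        by (simp add: agree_below_extend_iff)
      then have "agree_below b (f a) y"
        using \<open>agree_below b (extend A f (h y)) y\<close> f \<open>a \<in> A\<close>
        by (metis agree_below_trans extend_eq)
      with False \<open>a \<in> A\<close> show False by blast
    qed
    ultimately show ?thesis
      by (auto simp: extend_def[of A f])
  qed
  then show ?thesis
    unfolding h_def by (rule agree_everywhere_imp_eq)
qed

section \<open>The power set colored by first differences\<close>

lemma GEC_first_difference: "GEC V first_difference"
proof -
  have "first_difference x y = first_difference z z \<longleftrightarrow> x = y" for x y z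
    using first_difference_eq_None_iff by metis
  then show ?thesis
    unfolding GEC_def using first_difference_sym by blast
qed

lemma absolutely_homogeneous_Pow: "absolutely_homogeneous (Pow Y) first_difference"
  unfolding absolutely_homogeneous_def
proof (intro allI impI)
  fix A f
  assume "partial_morphism (Pow Y) first_difference A f"
  then have f: "preserves_first_difference A f"
    and A: "\<Union>A \<subseteq> Y" and fA: "\<Union>(f ` A) \<subseteq> Y"
    by (auto simp: partial_morphism_def preserves_first_difference_def)
  have closed: "extend A f ` Pow Y \<subseteq> Pow Y"
    using extend_subset[OF A fA] by blast
  have "inj_on (extend A f) (Pow Y)"
    by (rule inj_onI) (metis first_difference_eq_None_iff first_difference_extend)
  moreover have "Pow Y \<subseteq> extend A f ` Pow Y"
  proof
    fix y
    assume "y \<in> Pow Y"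
    moreover have "\<Union>(inv_into A f ` f ` A) \<subseteq> Y"
      using A preserves_first_difference_imp_inj_on[OF f] by simp
    ultimately have "extend (f ` A) (inv_into A f) y \<in> Pow Y"
      using extend_subset[OF fA] by simp
    then show "y \<in> extend A f ` Pow Y"
      using extend_inverse[OF f] by (metis imageI)
  qed
  ultimately have "automorphism (Pow Y) first_difference (extend A f)"
    using closed
    by (auto simp: automorphism_def partial_morphism_def bij_betw_def first_difference_extend)
  then show "\<exists>g. automorphism (Pow Y) first_difference g \<and> (\<forall>a\<in>A. g a = f a)"
    using extend_eq[OF f] by blast
qed

lemma Col_Pow: "Col (Pow Y) first_difference = Some ` Y"
proof
  show "Col (Pow Y) first_difference \<subseteq> Some ` Y"
  proof
    fix c
    assume "c \<in> Col (Pow Y) first_difference"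
    then obtain x y where xy: "x \<subseteq> Y" "y \<subseteq> Y" "x \<noteq> y" "c = first_difference x y"
      by (auto simp: Col_def)
    then obtain b where "c = Some b" "b \<in> x \<longleftrightarrow> b \<notin> y"
      by (metis first_difference_eq_None_iff first_difference_eq_Some_iff option.exhaust)
    with xy show "c \<in> Some ` Y" by blast
  qed
  show "Some ` Y \<subseteq> Col (Pow Y) first_difference"
  proof
    fix c
    assume "c \<in> Some ` Y"
    then obtain y where y: "y \<in> Y" "c = Some y" by blast
    have "first_difference {} {y} = c"
      using wf_R y by (auto simp: first_difference_eq_Some_iff agree_below_def)
    then have "c = first_difference {} {y}" ..
    moreover have "{} \<in> Pow Y" "{y} \<in> Pow Y" "{} \<noteq> {y}"
      using y by auto
    ultimately show "c \<in> Col (Pow Y) first_difference"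
      unfolding Col_def by blast
  qed
qed

end

lemma ex_strict_well_order: "\<exists>R :: 'a rel. strict_well_order R"
proof -
  obtain r :: "'a rel" where r: "well_order_on UNIV r"
    using well_order_on by blast
  have "strict_well_order (r - Id)"
  proof
    show "wf (r - Id)" "total (r - Id)" "trans (r - Id)"
      using r
      by (auto simp: well_order_on_def linear_order_on_def partial_order_on_def preorder_on_def
          intro: trans_diff_Id)
  qed
  then show ?thesis by blast
qed

theorem corollary4p6:
  fixes Y :: "'a set"
  assumes "infinite Y"
  shows "\<exists>(V :: 'a set set) (\<kappa> :: 'a set \<Rightarrow> 'a set \<Rightarrow> 'a option).
           GEC V \<kappa> \<and> absolutely_homogeneous V \<kappa> \<and>
           Col V \<kappa> = Some ` Y \<and> |V| =o ctwo ^c |Y|"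
proof -
  obtain R :: "'a rel" where "strict_well_order R"
    using ex_strict_well_order by blast
  then interpret strict_well_order R .
  have "|Pow Y| =o ctwo ^c |Y|"
    by (simp add: cexp_def ctwo_def Field_card_of card_of_Pow_Func)
  then show ?thesis
    using GEC_first_difference absolutely_homogeneous_Pow Col_Pow by blast
qed

end
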